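(* Let $p$ be a selective ultrafilter on $\omega$. Then every element $u$ of $\mathscr G^p$ generates a free subsemigroup of $\beta\omega$, i.e. for all $n,m\in\mathbb N$, $u^n=u^m$ iff $n=m$ (this is for nonprincipal $u$). In particular, no element of $\mathscr G^p$ is an idempotent ultrafilter (a nonprincipal $u$ with $u+u=u$).
   Context: $\beta\omega$ is the set of ultrafilters on $\omega$, $\mathbb N=\{1,2,\dots\}$. For $u,v\in\beta\omega$, $u+v=\{A\subseteq\omega : \{x : \{y : x+y\in A\}\in v\}\in u\}$ and $u^n=u+\cdots+u$ ($n$ summands). A nonprincipal ultrafilter $p$ on $\omega$ is selective if for every partition $\omega=\bigcup_{n<\omega}X_n$ either some $X_n\in p$ or there is $A\in p$ with $|A\cap X_n|\le1$ for all $n$. For ultrafilters $u,u_n$ ($n<\omega$), the $u$-limit $u\text{-}\lim_n u_n$ is the ultrafilter $\{A : \{n : A\in u_n\}\in u\}$. For $p\in\beta\omega$ define $\mathscr G^p_1$ = the set of principal ultrafilters on $\omega$, $\mathscr G^p_{\alpha+1}=\{p\text{-}\lim_n u_n : u_n\in\mathscr G^p_\alpha \text{ for all } n\}$, $\mathscr G^p_\alpha=\bigcup_{\xi<\alpha}\mathscr G^p_\xi$ for limit $\alpha$, and $\mathscr G^p=\bigcup_{\alpha\ge1}\mathscr G^p_\alpha$. *)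

theory Defs
  imports Complex_Main "HOL-Library.Disjoint_Sets"
begin

text \<open>
  Ultrafilters are represented by the library type of filters: a set \<open>A\<close> belongs to
  \<open>u\<close> iff \<open>\<forall>\<^sub>F x in u. x \<in> A\<close>, and equality of filters is equality of the
  corresponding families of sets. The improper filter \<open>bot\<close> has to be excluded.
\<close>

definition ultrafilter :: "'a filter \<Rightarrow> bool" where
  "ultrafilter u \<longleftrightarrow>
     u \<noteq> bot \<and> (\<forall>A. (\<forall>\<^sub>F x in u. x \<in> A) \<or> (\<forall>\<^sub>F x in u. x \<in> - A))"

definition nonprincipal :: "'a filter \<Rightarrow> bool" where
  "nonprincipal u \<longleftrightarrow> (\<forall>x. u \<noteq> principal {x})"

definition ultra_sum :: "nat filter \<Rightarrow> nat filter \<Rightarrow> nat filter" where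
  "ultra_sum u v = Abs_filter (\<lambda>P. \<forall>\<^sub>F x in u. \<forall>\<^sub>F y in v. P (x + y))"

definition ultra_lim :: "nat filter \<Rightarrow> (nat \<Rightarrow> 'a filter) \<Rightarrow> 'a filter" where
  "ultra_lim u U = Abs_filter (\<lambda>P. \<forall>\<^sub>F n in u. eventually P (U n))"

lemma eventually_ultra_sum:
  "eventually P (ultra_sum u v) \<longleftrightarrow> (\<forall>\<^sub>F x in u. \<forall>\<^sub>F y in v. P (x + y))"
  unfolding ultra_sum_def
  by (rule eventually_Abs_filter, rule is_filter.intro)
     (auto simp: eventually_conj_iff elim!: eventually_mono)

lemma eventually_ultra_lim:
  "eventually P (ultra_lim u U) \<longleftrightarrow> (\<forall>\<^sub>F n in u. eventually P (U n))"
  unfolding ultra_lim_def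
  by (rule eventually_Abs_filter, rule is_filter.intro)
     (auto simp: eventually_conj_iff elim!: eventually_mono)

text \<open>The sum of \<open>n\<close> copies of \<open>u\<close>; only meaningful for \<open>n \<ge> 1\<close>.\<close>

definition ultra_power :: "nat filter \<Rightarrow> nat \<Rightarrow> nat filter" where
  "ultra_power u n = ((\<lambda>v. ultra_sum v u) ^^ (n - 1)) u"

lemma ultra_power_1: "ultra_power u 1 = u"
  by (simp add: ultra_power_def)

lemma ultra_power_Suc: "n \<ge> 1 \<Longrightarrow> ultra_power u (Suc n) = ultra_sum (ultra_power u n) u"
  by (cases n) (simp_all add: ultra_power_def)

definition generates_free_subsemigroup :: "nat filter \<Rightarrow> bool" where
  "generates_free_subsemigroup u \<longleftrightarrow>
     (\<forall>n\<ge>1. \<forall>m\<ge>1. ultra_power u n = ultra_power u m \<longleftrightarrow> n = m)"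

definition idempotent_ultrafilter :: "nat filter \<Rightarrow> bool" where
  "idempotent_ultrafilter u \<longleftrightarrow> ultrafilter u \<and> nonprincipal u \<and> ultra_sum u u = u"

text \<open>
  Finiteness is demanded separately because \<^const>\<open>card\<close> is \<open>0\<close> on infinite sets. Cells of the
  partition may be empty.
\<close>

definition selective :: "nat filter \<Rightarrow> bool" where
  "selective p \<longleftrightarrow> ultrafilter p \<and> nonprincipal p \<and>
     (\<forall>X :: nat \<Rightarrow> nat set. disjoint_family X \<and> (\<Union>n. X n) = UNIV \<longrightarrow>
        (\<exists>n. \<forall>\<^sub>F x in p. x \<in> X n) \<or>
        (\<exists>A. (\<forall>\<^sub>F x in p. x \<in> A) \<and> (\<forall>n. finite (A \<inter> X n) \<and> card (A \<inter> X n) \<le> 1)))"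

text \<open>
  Ordinals \<open>\<alpha> \<ge> 1\<close> are represented by the elements of a well-order \<open>r\<close>, the least element
  standing for \<open>1\<close>. If \<open>underS r a = under r b\<close> with \<open>b\<close> in the field, then \<open>a\<close> is the
  immediate successor of \<open>b\<close>; the elements that are neither least nor successors are limits.
\<close>

definition G_level :: "'i rel \<Rightarrow> nat filter \<Rightarrow> 'i \<Rightarrow> nat filter set" where
  "G_level r p = wo_rel.worec r (\<lambda>G a.
     if underS r a = {} then range (\<lambda>n. principal {n})
     else if \<exists>b\<in>Field r. underS r a = under r b
     then {ultra_lim p U | U b. b \<in> Field r \<and> underS r a = under r b \<and> (\<forall>n. U n \<in> G b)}
     else (\<Union>b\<in>underS r a. G b))"

text \<open>
  The union over all ordinals. Well-orders on the type \<^typ>\<open>nat set\<close> include one of type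
  \<open>\<omega>\<^sub>1\<close>, which is enough: lemma \<open>G_level_subset_G_class\<close> below shows that no well-order on
  any type contributes further ultrafilters.
\<close>

definition G_class :: "nat filter \<Rightarrow> nat filter set" where
  "G_class p = \<Union> {G_level r p a | (r :: nat set rel) a. Well_order r \<and> a \<in> Field r}"

lemma G_level_unfold:
  fixes r :: "'a rel"
  assumes "Well_order r"
  shows "G_level r p a =
    (if underS r a = {} then range (\<lambda>n. principal {n})
     else if \<exists>b\<in>Field r. underS r a = under r b
     then {ultra_lim p U | U b. b \<in> Field r \<and> underS r a = under r b \<and> (\<forall>n. U n \<in> G_level r p b)}
     else (\<Union>b\<in>underS r a. G_level r p b))"
proof -
  interpret wo_rel r using assms by (simp add: wo_rel_def)
  let ?H = "\<lambda>(G :: 'a \<Rightarrow> nat filter set) a.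
     if underS a = {} then range (\<lambda>n. principal {n})
     else if \<exists>b\<in>Field r. underS a = under b
     then {ultra_lim p U | U b. b \<in> Field r \<and> underS a = under b \<and> (\<forall>n. U n \<in> G b)}
     else (\<Union>b\<in>underS a. G b)"
  have "adm_wo ?H"
    unfolding adm_wo_def
  proof (intro allI impI)
    fix G G' :: "'a \<Rightarrow> nat filter set" and a :: 'a
    assume eq: "\<forall>b\<in>underS a. G b = G' b"
    have "G b = G' b" if "b \<in> Field r" "underS a = under b" for b
    proof -
      have "b \<in> under b"
        using that(1) REFL by (auto simp: under_def refl_on_def)
      then show ?thesis using eq that(2) by auto
    qed
    then have "{ultra_lim p U | U b. b \<in> Field r \<and> underS a = under b \<and> (\<forall>n. U n \<in> G b)} =
               {ultra_lim p U | U b. b \<in> Field r \<and> underS a = under b \<and> (\<forall>n. U n \<in> G' b)}"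
      by (intro Collect_cong ex_cong1 conj_cong refl) auto
    then show "?H G a = ?H G' a"
      using eq by auto
  qed
  from fun_cong[OF worec_fixpoint[OF this], of a] show ?thesis
    unfolding G_level_def .
qed

lemma G_level_least:
  assumes "Well_order r" "underS r a = {}"
  shows "G_level r p a = range (\<lambda>n. principal {n})"
  by (subst G_level_unfold[OF assms(1)]) (simp add: assms(2))

lemma G_level_succ:
  assumes r: "Well_order r" and b: "b \<in> Field r" and ab: "underS r a = under r b"
  shows "G_level r p a = {ultra_lim p U | U. \<forall>n. U n \<in> G_level r p b}"
proof -
  interpret wo_rel r using r by (simp add: wo_rel_def)
  have refl: "c \<in> under c" if "c \<in> Field r" for c
    using that REFL by (auto simp: under_def refl_on_def)
  have uniq: "c = b" if "c \<in> Field r" "underS a = under c" for c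
  proof (rule antisymD[OF ANTISYM])
    show "(c, b) \<in> r" using refl[OF that(1)] that(2) ab by (auto simp: under_def)
    show "(b, c) \<in> r" using refl[OF b] that(2) ab by (auto simp: under_def)
  qed
  have "underS a \<noteq> {}" using refl[OF b] ab by auto
  then have "G_level r p a =
      {ultra_lim p U | U c. c \<in> Field r \<and> underS a = under c \<and> (\<forall>n. U n \<in> G_level r p c)}"
    using b ab by (subst G_level_unfold[OF r]) (simp only: if_False if_True bexI[of _ b])
  also have "\<dots> = {ultra_lim p U | U. \<forall>n. U n \<in> G_level r p b}"
    using uniq b ab by blast
  finally show ?thesis .
qed

lemma G_level_limit:
  assumes "Well_order r" "underS r a \<noteq> {}" "\<forall>b\<in>Field r. underS r a \<noteq> under r b"
  shows "G_level r p a = (\<Union>b\<in>underS r a. G_level r p b)"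
  by (subst G_level_unfold[OF assms(1)]) (use assms(2,3) in auto)

lemma ultra_lim_const:
  assumes "p \<noteq> bot"
  shows "ultra_lim p (\<lambda>_. u) = u"
  using assms by (simp add: filter_eq_iff eventually_ultra_lim)

lemma G_level_mono:
  assumes r: "Well_order r" and p: "p \<noteq> bot" and "(b, a) \<in> r"
  shows "G_level r p b \<subseteq> G_level r p a"
  using assms(3)
proof (induction a arbitrary: b rule: wo_rel.well_order_induct[of r])
  case 1
  show ?case using r by (simp add: wo_rel_def)
next
  case (2 a)
  interpret wo_rel r using r by (simp add: wo_rel_def)
  show ?case
  proof (cases "b = a")
    case False
    then have ba: "b \<in> underS a" using 2(2) by (auto simp: underS_def)
    show ?thesis
    proof (cases "\<exists>c\<in>Field r. underS a = under c")
      case True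
      then obtain c where c: "c \<in> Field r" "underS a = under c" by blast
      have "c \<in> under c" using c(1) REFL by (auto simp: under_def refl_on_def)
      then have "c \<in> underS a" using c by auto
      then have "c \<noteq> a" "(c, a) \<in> r" by (auto simp: underS_def)
      moreover have "(b, c) \<in> r" using ba c by (auto simp: under_def)
      ultimately have "G_level r p b \<subseteq> G_level r p c" using 2(1) by blast
      moreover have "G_level r p c \<subseteq> G_level r p a"
      proof
        fix u assume "u \<in> G_level r p c"
        then show "u \<in> G_level r p a"
          unfolding G_level_succ[OF r c] using ultra_lim_const[OF p, of u]
          by (intro CollectI exI[of _ "\<lambda>_. u"]) auto
      qed
      ultimately show ?thesis by blast
    next
      case False
      then show ?thesis using G_level_limit[OF r, of a p] ba by auto
    qed
  qed simp
qed

inductive_set G_closure :: "nat filter \<Rightarrow> nat filter set" for p where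
  principal: "principal {n} \<in> G_closure p"
| lim: "(\<And>n. U n \<in> G_closure p) \<Longrightarrow> ultra_lim p U \<in> G_closure p"

lemma G_level_subset_G_closure:
  assumes r: "Well_order r"
  shows "G_level r p a \<subseteq> G_closure p"
proof (induction a rule: wo_rel.well_order_induct[of r])
  case 1
  show ?case using r by (simp add: wo_rel_def)
next
  case (2 a)
  interpret wo_rel r using r by (simp add: wo_rel_def)
  show ?case
  proof (cases "underS a = {}")
    case True
    then show ?thesis using G_level_least[OF r] by (auto intro: G_closure.principal)
  next
    case False
    note ne = False
    show ?thesis
    proof (cases "\<exists>c\<in>Field r. underS a = under c")
      case True
      then obtain c where c: "c \<in> Field r" "underS a = under c" by blast
      have "c \<in> under c" using c(1) REFL by (auto simp: under_def refl_on_def)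
      then have "c \<in> underS a" using c by auto
      then have "G_level r p c \<subseteq> G_closure p" using 2 by (auto simp: underS_def)
      then show ?thesis
        unfolding G_level_succ[OF r c] by (auto intro: G_closure.lim)
    next
      case False
      then have "G_level r p a = (\<Union>b\<in>underS a. G_level r p b)"
        using G_level_limit[OF r ne] by blast
      then show ?thesis using 2 by (auto simp: underS_def)
    qed
  qed
qed

lemma G_closure_subset_G_class:
  assumes p: "p \<noteq> bot"
  shows "G_closure p \<subseteq> G_class p"
proof -
  define r where "r = cardSuc natLeq"
  have cr: "Card_order r" unfolding r_def
    by (rule cardSuc_Card_order[OF natLeq_Card_order])
  then have r: "Well_order r" by (simp add: card_order_on_def)
  interpret wo_rel r using r by (simp add: wo_rel_def)
  have inf: "\<not> finite (Field r)"
    unfolding r_def by (simp add: cardSuc_finite[OF natLeq_Card_order] Field_natLeq)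
  have "u \<in> (\<Union>a\<in>Field r. G_level r p a)" if "u \<in> G_closure p" for u
    using that
  proof induction
    case (principal n)
    have ne: "Field r \<noteq> {}" using inf by auto
    let ?z = "minim (Field r)"
    have z: "?z \<in> Field r" using minim_inField[OF subset_refl ne] .
    have "underS ?z = {}"
      using minim_least[OF subset_refl] ANTISYM
      by (auto simp: underS_def Field_def antisym_def)
    from G_level_least[OF r this] z show ?case by blast
  next
    case (lim U)
    have "\<exists>i\<in>Field (cardSuc natLeq). range U \<subseteq> G_level r p i"
    proof (rule cardSuc_UNION[OF natLeq_Card_order])
      show "\<not> finite (Field natLeq)" by (simp add: Field_natLeq)
      show "relChain (cardSuc natLeq) (G_level r p)"
        using G_level_mono[OF r p] unfolding relChain_def r_def by blast
      show "range U \<subseteq> (\<Union>i\<in>Field (cardSuc natLeq). G_level r p i)"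
        using lim.IH unfolding r_def by blast
      show "(card_of (range U), natLeq) \<in> ordLeq"
        using ordLeq_ordIso_trans[OF card_of_image card_of_nat] .
    qed
    then obtain c where c: "c \<in> Field r" "\<And>n. U n \<in> G_level r p c"
      unfolding r_def by blast
    have "AboveS {c} \<noteq> {}"
      using infinite_Card_order_limit[OF cr inf c(1)] c(1) by (auto simp: AboveS_def)
    then have sub: "{c} \<subseteq> Field r" and ne: "AboveS {c} \<noteq> {}" using c(1) by auto
    let ?a = "suc {c}"
    have a: "?a \<in> Field r" using suc_inField[OF sub ne] .
    have gt: "?a \<noteq> c" "(c, ?a) \<in> r" using suc_greater[OF sub ne, of c] by auto
    have "underS ?a = under c"
    proof
      show "under c \<subseteq> underS ?a"
      proof
        fix x assume "x \<in> under c"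
        then have x: "(x, c) \<in> r" by (simp add: under_def)
        then have "(x, ?a) \<in> r" using transD[OF TRANS] gt(2) by blast
        moreover have "x \<noteq> ?a" using antisymD[OF ANTISYM x] gt by blast
        ultimately show "x \<in> underS ?a" by (simp add: underS_def)
      qed
      show "underS ?a \<subseteq> under c"
      proof
        fix x assume x: "x \<in> underS ?a"
        then have xF: "x \<in> Field r" by (auto simp: underS_def Field_def)
        show "x \<in> under c"
        proof (rule ccontr)
          assume "x \<notin> under c"
          then have "(x, c) \<notin> r" by (simp add: under_def)
          then have "(c, x) \<in> r" "c \<noteq> x"
            using TOTALS xF c(1) REFL by (auto simp: refl_on_def)
          then have "x \<in> AboveS {c}" using xF by (auto simp: AboveS_def)
          then have "(?a, x) \<in> r" by (rule suc_least_AboveS)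
          then show False using x ANTISYM by (auto simp: underS_def antisym_def)
        qed
      qed
    qed
    from G_level_succ[OF r c(1) this] c(2) have "ultra_lim p U \<in> G_level r p ?a" by blast
    then show ?case using a by blast
  qed
  then show ?thesis using r unfolding G_class_def by blast
qed

lemma G_level_subset_G_class:
  assumes "ultrafilter p" "Well_order r"
  shows "G_level r p a \<subseteq> G_class p"
  using G_level_subset_G_closure[OF assms(2)] G_closure_subset_G_class[of p] assms(1)
  by (auto simp: ultrafilter_def)

lemma G_class_ultrafilter:
  assumes p: "ultrafilter p" and "u \<in> G_class p"
  shows "ultrafilter u"
proof -
  obtain r :: "nat set rel" and a where r: "Well_order r" and u: "u \<in> G_level r p a"
    using assms(2) unfolding G_class_def by blast
  have "u \<in> G_closure p"
    by (rule subsetD[OF G_level_subset_G_closure[OF r] u])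
  then show ?thesis
  proof induction
    case (principal n)
    then show ?case
      by (auto simp: ultrafilter_def eventually_principal principal_eq_bot_iff)
  next
    case (lim U)
    show ?case unfolding ultrafilter_def
    proof (intro conjI allI)
      have "\<not> eventually (\<lambda>_. False) (U n)" for n
        using lim.IH[of n] by (simp add: ultrafilter_def eventually_False)
      then show "ultra_lim p U \<noteq> bot"
        using p by (simp add: trivial_limit_def eventually_ultra_lim ultrafilter_def)
      fix A
      let ?B = "{n. \<forall>\<^sub>F x in U n. x \<in> A}"
      have "(\<forall>\<^sub>F n in p. n \<in> ?B) \<or> (\<forall>\<^sub>F n in p. n \<in> - ?B)"
        using p by (simp only: ultrafilter_def)
      moreover have "(\<forall>\<^sub>F n in p. \<forall>\<^sub>F x in U n. x \<in> - A)" if "\<forall>\<^sub>F n in p. n \<in> - ?B"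
        using that by (rule eventually_mono) (use lim.IH in \<open>auto simp: ultrafilter_def\<close>)
      ultimately show "(\<forall>\<^sub>F x in ultra_lim p U. x \<in> A) \<or> (\<forall>\<^sub>F x in ultra_lim p U. x \<in> - A)"
        unfolding eventually_ultra_lim by (simp only: mem_Collect_eq) blast
    qed
  qed
qed

end

theory Submission
  imports Defs
begin

text \<open>
  If \<open>p\<close> is selective and \<open>p\<close>-\<open>lim U = p\<close>-\<open>lim V\<close> with neither sequence constant
  \<open>p\<close>-almost everywhere, a diagonal intersection separates the points \<open>U n\<close>, \<open>V n\<close> by
  disjoint sets \<open>C n \<in> U n \<inter> V n\<close>, so that \<open>U n = V n\<close> for \<open>p\<close>-almost all \<open>n\<close>.

  If \<open>u\<^sup>n = u\<^sup>m\<close> with \<open>n \<noteq> m\<close>, some power of \<open>u\<close> is an idempotent \<open>e\<close>, again in \<open>\<G>\<^sup>p\<close>.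
  Then no \<open>c \<in> \<G>\<^sup>p\<close> is of the form \<open>s + e\<close> with \<open>s \<in> \<G>\<^sup>p\<close>, by induction on \<open>c\<close>: if
  \<open>s = p\<close>-\<open>lim s\<^sub>n\<close> and \<open>c = p\<close>-\<open>lim c\<^sub>n\<close>, then \<open>s + e = p\<close>-\<open>lim (s\<^sub>n + e)\<close>, so uniqueness
  gives \<open>s\<^sub>n + e = c\<^sub>n\<close> or \<open>s\<^sub>n + e = c\<close>. The former contradicts the induction hypothesis;
  descending through the latter, \<open>s\<close> must be principal, but \<open>s + e\<close> is also a possible choice for
  \<open>s\<close> and is not principal. The choice \<open>s = c = e\<close> is a contradiction.
\<close>

section \<open>Ultrafilters and their sums\<close>

lemma ultrafilter_not_eventually:
  assumes "ultrafilter u"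
  shows "\<not> eventually P u \<longleftrightarrow> eventually (\<lambda>x. \<not> P x) u"
proof
  assume "\<not> eventually P u"
  then show "eventually (\<lambda>x. \<not> P x) u"
    using assms[unfolded ultrafilter_def, THEN conjunct2, rule_format, of "Collect P"] by simp
next
  assume "eventually (\<lambda>x. \<not> P x) u"
  then show "\<not> eventually P u"
    using assms eventually_conj[of P u "\<lambda>x. \<not> P x"] by (auto simp: ultrafilter_def eventually_False)
qed

lemma ultrafilter_le_eq:
  assumes u: "ultrafilter u" and v: "v \<noteq> bot" and le: "v \<le> u"
  shows "v = u"
proof (rule antisym[OF le], rule filter_leI)
  fix P assume P: "eventually P v"
  show "eventually P u"
  proof (rule ccontr)
    assume "\<not> eventually P u"
    then have "eventually (\<lambda>x. \<not> P x) v"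
      using ultrafilter_not_eventually[OF u] filter_leD[OF le] by blast
    with P have "eventually (\<lambda>_. False) v" by eventually_elim auto
    with v show False by (simp add: eventually_False)
  qed
qed

lemma ultrafilter_separate:
  assumes "ultrafilter u" "ultrafilter v" "u \<noteq> v"
  shows "\<exists>A. eventually (\<lambda>x. x \<in> A) u \<and> eventually (\<lambda>x. x \<notin> A) v"
proof -
  have "\<not> v \<le> u" using ultrafilter_le_eq[of u v] assms by (auto simp: ultrafilter_def)
  then obtain P where "eventually P u" "\<not> eventually P v" by (auto simp: le_filter_def)
  then show ?thesis using ultrafilter_not_eventually[OF assms(2)]
    by (intro exI[of _ "Collect P"]) auto
qed

lemma eventually_eq_principal:
  assumes "u \<noteq> bot" "eventually (\<lambda>x. x = c) u"
  shows "u = principal {c}"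
proof (rule antisym)
  show "u \<le> principal {c}" using assms(2) by (simp add: le_principal)
  show "principal {c} \<le> u"
  proof (rule filter_leI)
    fix P assume "eventually P u"
    then have "eventually (\<lambda>x. P c) u" using assms(2) by eventually_elim auto
    then show "eventually P (principal {c})" using assms(1) by (auto simp: eventually_principal)
  qed
qed

lemma ultra_sum_principal_left:
  "eventually P (ultra_sum (principal {k}) v) \<longleftrightarrow> eventually (\<lambda>y. P (k + y)) v"
  by (simp add: eventually_ultra_sum eventually_principal)

lemma nonprincipal_ultra_sum:
  assumes "u \<noteq> bot" "v \<noteq> bot" "nonprincipal v"
  shows "nonprincipal (ultra_sum u v)"
  unfolding nonprincipal_def
proof (intro allI notI)
  fix z assume "ultra_sum u v = principal {z}"
  then have "\<forall>\<^sub>F x in u. \<forall>\<^sub>F y in v. x + y = z"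
    using eventually_ultra_sum[of "\<lambda>w. w = z" u v] by (simp add: eventually_principal)
  then obtain x where "\<forall>\<^sub>F y in v. x + y = z"
    using eventually_happens' assms(1) by blast
  then have "\<forall>\<^sub>F y in v. y = z - x" by eventually_elim auto
  then show False using eventually_eq_principal[OF assms(2)] assms(3) by (simp add: nonprincipal_def)
qed

lemma ultra_sum_assoc: "ultra_sum (ultra_sum u v) w = ultra_sum u (ultra_sum v w)"
  by (simp add: filter_eq_iff eventually_ultra_sum add.assoc)

text \<open>The left summand is the outer quantifier, so addition is continuous in it. A limit
  representation of \<open>s\<close> thereby becomes one of \<open>ultra_sum s e\<close>.\<close>

lemma ultra_sum_lim_left: "ultra_sum (ultra_lim p U) v = ultra_lim p (\<lambda>n. ultra_sum (U n) v)"
  by (simp add: filter_eq_iff eventually_ultra_sum eventually_ultra_lim)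

text \<open>An ultrafilter contains exactly one residue class modulo \<open>M\<close>, so the
  translate by \<open>k\<close> determines \<open>k\<close> modulo \<open>M\<close>. A modulus
  larger than both \<open>k\<close> and \<open>m\<close> tells them apart.\<close>

lemma ultra_sum_principal_cancel:
  assumes e: "ultrafilter e" and eq: "ultra_sum (principal {k}) e = ultra_sum (principal {m}) e"
  shows "k = m"
proof -
  define M where "M = k + m + 1"
  have "\<exists>r\<in>{..<M}. \<forall>\<^sub>F y in e. y mod M = r"
  proof (rule ccontr)
    assume "\<not> ?thesis"
    then have "\<forall>r\<in>{..<M}. \<forall>\<^sub>F y in e. y mod M \<noteq> r" using ultrafilter_not_eventually[OF e] by blast
    then have "\<forall>\<^sub>F y in e. \<forall>r\<in>{..<M}. y mod M \<noteq> r" by (intro eventually_ball_finite) auto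
    then have "\<forall>\<^sub>F y in e. False" by eventually_elim (auto simp: M_def)
    then show False using e by (simp add: ultrafilter_def eventually_False)
  qed
  then obtain r where r: "\<forall>\<^sub>F y in e. y mod M = r" by blast
  have "\<forall>\<^sub>F z in ultra_sum (principal {k}) e. z mod M = (k + r) mod M"
    unfolding ultra_sum_principal_left using r by eventually_elim (drule sym, simp add: mod_simps)
  then have "\<forall>\<^sub>F y in e. (m + y) mod M = (k + r) mod M"
    unfolding eq ultra_sum_principal_left .
  then have "\<forall>\<^sub>F y in e. (m + r) mod M = (k + r) mod M"
    using r by eventually_elim (drule sym, simp add: mod_simps)
  then have "(m + r) mod M = (k + r) mod M"
    using e by (auto simp: ultrafilter_def)
  then have "(int m + int r) mod int M = (int k + int r) mod int M"
    by (metis of_nat_add zmod_int)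
  then have "int M dvd int m - int k" by (simp add: mod_eq_dvd_iff)
  then show ?thesis using dvd_imp_le_int[of "int m - int k" "int M"] unfolding M_def by linarith
qed

section \<open>Powers of an ultrafilter\<close>

lemma ultra_power_add:
  assumes "n \<ge> 1" "m \<ge> 1"
  shows "ultra_power u (n + m) = ultra_sum (ultra_power u n) (ultra_power u m)"
  using assms(2)
proof (induction m rule: dec_induct)
  case base
  show ?case using ultra_power_Suc[OF assms(1), of u] by (simp add: ultra_power_1[simplified])
next
  case (step m)
  then show ?case
    using ultra_power_Suc[of "n + m" u] ultra_power_Suc[of m u] by (simp add: ultra_sum_assoc)
qed

text \<open>From exponent \<open>n\<close> on, the powers repeat with period
  \<open>k = m - n\<close>. The exponent \<open>n * k\<close> is at least \<open>n\<close> and a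
  multiple of the period, so doubling it changes nothing.\<close>

lemma ultra_power_idempotent:
  assumes n: "n \<ge> 1" "n < m" and eq: "ultra_power u n = ultra_power u m"
  shows "\<exists>N\<ge>1. ultra_sum (ultra_power u N) (ultra_power u N) = ultra_power u N"
proof -
  define k where "k = m - n"
  have k: "k \<ge> 1" "m = n + k" using n by (auto simp: k_def)
  have step: "ultra_power u (i + k) = ultra_power u i" if "i \<ge> n" for i
  proof (cases "i = n")
    case False
    then have j: "i = n + (i - n)" "i - n \<ge> 1" using that by auto
    have "ultra_power u (i + k) = ultra_power u (m + (i - n))"
      using j k by (intro arg_cong[of _ _ "ultra_power u"]) simp
    also have "\<dots> = ultra_power u (n + (i - n))" 
      using ultra_power_add[OF n(1) j(2), of u] ultra_power_add[OF order.trans[OF n(1) less_imp_le[OF n(2)]] j(2), of u] eq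
      by (simp only:)
    finally show ?thesis using j by simp
  qed (use eq k in simp)
  have steps: "ultra_power u (i + j * k) = ultra_power u i" if "i \<ge> n" for i j
  proof (induction j)
    case (Suc j)
    then show ?case using step[of "i + j * k"] that by (simp add: ac_simps)
  qed simp
  have N: "n * k \<ge> n" "n * k \<ge> 1" using n k by auto
  have "ultra_power u (n * k + n * k) = ultra_power u (n * k)" by (rule steps[OF N(1)])
  then show ?thesis using N(2) ultra_power_add[OF N(2) N(2), of u] by (intro exI[of _ "n * k"]) simp
qed

section \<open>Selective ultrafilters\<close>

text \<open>Applied to the fibres of \<open>f\<close>, selectivity takes its functional form: each
  function is constant or injective on a set of \<open>p\<close>.\<close>

lemma selective_fun:
  fixes f :: "nat \<Rightarrow> nat"
  assumes "selective p"
  shows "(\<exists>n. \<forall>\<^sub>F x in p. f x = n) \<or> (\<exists>A. (\<forall>\<^sub>F x in p. x \<in> A) \<and> inj_on f A)"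
proof -
  let ?X = "\<lambda>n. f -` {n}"
  have "disjoint_family ?X \<and> (\<Union>n. ?X n) = UNIV" by (auto simp: disjoint_family_on_def)
  then consider n where "\<forall>\<^sub>F x in p. x \<in> ?X n"
    | A where "\<forall>\<^sub>F x in p. x \<in> A" "\<forall>n. finite (A \<inter> ?X n) \<and> card (A \<inter> ?X n) \<le> 1"
    using assms unfolding selective_def by metis
  then show ?thesis
  proof cases
    case (2 A)
    have "inj_on f A"
    proof (rule inj_onI)
      fix x y assume "x \<in> A" "y \<in> A" "f x = f y"
      then show "x = y" using 2(2)[rule_format, of "f x"] by (auto simp: card_le_Suc0_iff_eq)
    qed
    with 2 show ?thesis by blast
  qed auto
qed

lemma selective_gt:
  assumes "selective p"
  shows "\<forall>\<^sub>F x in p. n < (x::nat)"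
proof -
  have p: "ultrafilter p" "nonprincipal p" using assms by (auto simp: selective_def)
  have "\<forall>\<^sub>F x in p. x \<noteq> k" for k
  proof (rule ccontr)
    assume "\<not> ?thesis"
    then have "\<forall>\<^sub>F x in p. x = k" using ultrafilter_not_eventually[OF p(1)] by auto
    then have "p = principal {k}" using p(1) by (intro eventually_eq_principal) (auto simp: ultrafilter_def)
    then show False using p(2) by (simp add: nonprincipal_def)
  qed
  then have "\<forall>\<^sub>F x in p. \<forall>k\<in>{..n}. x \<noteq> k" by (intro eventually_ball_finite) auto
  then show ?thesis by eventually_elim force
qed

text \<open>Selectivity is used twice: for a set \<open>A0\<close> almost contained in every
  \<open>F n\<close>, then for a set meeting each interval of a suitable partition at most
  once.\<close>

lemma selective_diagonal:
  fixes E :: "nat \<Rightarrow> nat set"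
  assumes sel: "selective p" and E: "\<And>n. \<forall>\<^sub>F x in p. x \<in> E n"
  shows "\<exists>A. (\<forall>\<^sub>F x in p. x \<in> A) \<and> (\<forall>n\<in>A. \<forall>m\<in>A. n < m \<longrightarrow> m \<in> E n)"
proof -
  have p: "ultrafilter p" using sel by (simp add: selective_def)
  have nF: "\<not> eventually (\<lambda>_. False) p" using p by (simp add: ultrafilter_def eventually_False)
  \<comment> \<open>Cumulative, so that membership in \<open>F\<close> at any index beyond
    \<open>n\<close> still yields membership in \<open>E n\<close>. The clause \<open>n < m\<close>
    gives \<open>m\<close> \<notin> \<open>F m\<close>, so the least index in \<open>f\<close>
    exists.\<close>
  define F where "F n = {m. n < m \<and> (\<forall>k\<le>n. m \<in> E k)}" for n
  have F: "\<forall>\<^sub>F x in p. x \<in> F n" for n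
  proof -
    have "\<forall>\<^sub>F x in p. \<forall>k\<in>{..n}. x \<in> E k" using E by (intro eventually_ball_finite) auto
    with selective_gt[OF sel, of n] show ?thesis by eventually_elim (auto simp: F_def)
  qed
  define f where "f m = (LEAST n. m \<notin> F n)" for m
  have fm: "m \<notin> F (f m)" for m unfolding f_def by (rule LeastI[of _ m]) (simp add: F_def)
  have f_le: "f m \<le> n" if "m \<notin> F n" for m n unfolding f_def using that by (rule Least_le)
  have "\<not> (\<forall>\<^sub>F x in p. f x = n)" for n
  proof
    assume "\<forall>\<^sub>F x in p. f x = n"
    with F[of n] have "\<forall>\<^sub>F x in p. False" by eventually_elim (use fm in auto)
    with nF show False by simp
  qed
  then obtain A0 where A0: "\<forall>\<^sub>F x in p. x \<in> A0" and inj: "inj_on f A0"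
    using selective_fun[OF sel, of f] by blast
  have fin: "finite (A0 - F n)" for n
  proof (rule inj_on_finite)
    show "inj_on f (A0 - F n)" using inj by (rule inj_on_subset) auto
    show "f ` (A0 - F n) \<subseteq> {..n}" using f_le by auto
  qed simp
  \<comment> \<open>All points of \<open>A0\<close> from \<open>h n\<close> on lie in
    \<open>F n\<close>. Inserting \<open>n\<close> keeps the maximum defined and ensures
    \<open>n < h n\<close>.\<close>
  define h where "h n = Suc (Max (insert n (A0 - F n)))" for n
  have h_gt: "n < h n" for n unfolding h_def using fin[of n] by (simp add: less_Suc_eq_le)
  have h: "m \<in> F n" if "m \<in> A0" "h n \<le> m" for m n
  proof (rule ccontr)
    assume "m \<notin> F n"
    then have "m \<le> Max (insert n (A0 - F n))" using that fin[of n] by (intro Max_ge) auto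
    then show False using that by (simp add: h_def)
  qed
  \<comment> \<open>The iterates of \<open>h\<close> cut \<omega> into finite intervals, and
    \<open>g m\<close> is the number of the interval containing \<open>m\<close>. Hence
    \<open>g\<close> is constant on no set of \<open>p\<close>.\<close>
  define a where "a i = (h ^^ i) 0" for i
  have a_Suc: "a (Suc i) = h (a i)" for i by (simp add: a_def)
  have mono: "strict_mono a" by (simp add: strict_mono_Suc_iff a_Suc h_gt)
  define g where "g m = (LEAST i. m < a (Suc i))" for m
  have g_lt: "m < a (Suc (g m))" for m unfolding g_def
    by (rule LeastI[of _ m]) (use strict_mono_imp_increasing[OF mono, of "Suc m"] in simp)
  have g_ge: "a i \<le> m" if "i \<le> g m" for i m
  proof (cases i)
    case (Suc j)
    then have "\<not> m < a (Suc j)" using that not_less_Least[of j "\<lambda>i. m < a (Suc i)"] by (auto simp: g_def)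
    with Suc show ?thesis by simp
  qed (simp add: a_def)
  have g_mono: "g n \<le> g m" if "n \<le> m" for n m
    unfolding g_def[of n] by (rule Least_le) (use g_lt[of m] that in simp)
  have "\<not> (\<forall>\<^sub>F x in p. g x = n)" for n
  proof
    assume "\<forall>\<^sub>F x in p. g x = n"
    with selective_gt[OF sel, of "a (Suc n)"] have "\<forall>\<^sub>F x in p. False"
      by eventually_elim (use g_lt less_asym in blast)
    with nF show False by simp
  qed
  then obtain A1 where A1: "\<forall>\<^sub>F x in p. x \<in> A1" and inj1: "inj_on g A1"
    using selective_fun[OF sel, of g] by blast
  obtain b where b: "\<forall>\<^sub>F x in p. even (g x) = b"
    using ultrafilter_not_eventually[OF p, of "\<lambda>x. even (g x)"] that[of True] that[of False]
    by (cases "\<forall>\<^sub>F x in p. even (g x)") simp_all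
  define A where "A = A0 \<inter> A1 \<inter> {x. even (g x) = b}"
  have "\<forall>\<^sub>F x in p. x \<in> A" using A0 A1 b by eventually_elim (auto simp: A_def)
  moreover have "m \<in> E n" if "n \<in> A" "m \<in> A" "n < m" for n m
  proof -
    have "g n \<noteq> g m" using that inj1 by (auto simp: A_def inj_on_def)
    then have "g n < g m" using g_mono[of n m] that by simp
    \<comment> \<open>equal parity leaves a whole interval of the partition between \<open>n\<close> and \<open>m\<close>\<close>
    moreover have "g m \<noteq> Suc (g n)" using that by (auto simp: A_def)
    ultimately have "Suc (Suc (g n)) \<le> g m" by simp
    then have "h (a (Suc (g n))) \<le> m" using g_ge a_Suc by metis
    then have "m \<in> F (a (Suc (g n)))" using h that by (auto simp: A_def)
    then show "m \<in> E n" using g_lt[of n] by (simp add: F_def)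
  qed
  ultimately show ?thesis by blast
qed

section \<open>Limits along a selective ultrafilter\<close>

lemma ultra_lim_eventually_const:
  assumes "p \<noteq> bot" "\<forall>\<^sub>F n in p. U n = c"
  shows "ultra_lim p U = c"
proof -
  have "(\<forall>\<^sub>F n in p. eventually P (U n)) = eventually P c" for P
  proof -
    have "(\<forall>\<^sub>F n in p. eventually P (U n)) = (\<forall>\<^sub>F n in p. eventually P c)"
      by (rule eventually_cong[OF assms(2)]) simp
    then show ?thesis using assms(1) by simp
  qed
  then show ?thesis by (simp add: filter_eq_iff eventually_ultra_lim)
qed

text \<open>The constant sequence \<open>w\<close> also has limit \<open>w\<close>, hence the two
  nonconstancy hypotheses. Otherwise, sets telling \<open>U n\<close> from \<open>V n\<close> can be
  glued along the disjoint \<open>C n\<close> into one set telling the limits apart.\<close>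

lemma selective_lim_unique:
  assumes sel: "selective p"
    and U: "\<And>n. ultrafilter (U n)" and V: "\<And>n. ultrafilter (V n)"
    and w: "ultrafilter w" "ultra_lim p U = w" "ultra_lim p V = w"
    and ncU: "\<not> (\<forall>\<^sub>F n in p. U n = w)" and ncV: "\<not> (\<forall>\<^sub>F n in p. V n = w)"
  shows "\<forall>\<^sub>F n in p. U n = V n"
proof (rule ccontr)
  assume neg: "\<not> ?thesis"
  have p: "ultrafilter p" using sel by (simp add: selective_def)
  have limU: "(\<forall>\<^sub>F n in p. eventually P (U n)) \<longleftrightarrow> eventually P w"
    and limV: "(\<forall>\<^sub>F n in p. eventually P (V n)) \<longleftrightarrow> eventually P w" for P
    using w(2,3) by (simp_all flip: eventually_ultra_lim)
  have nU: "\<forall>\<^sub>F n in p. U n \<noteq> w" and nV: "\<forall>\<^sub>F n in p. V n \<noteq> w"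
    and ne: "\<forall>\<^sub>F n in p. U n \<noteq> V n"
    using ncU ncV neg ultrafilter_not_eventually[OF p] by auto
  have "\<exists>B. (\<forall>\<^sub>F x in w. x \<in> B) \<and> (U n \<noteq> w \<longrightarrow> (\<forall>\<^sub>F x in U n. x \<notin> B))
      \<and> (V n \<noteq> w \<longrightarrow> (\<forall>\<^sub>F x in V n. x \<notin> B))" for n
  proof -
    have *: "\<exists>B. (\<forall>\<^sub>F x in w. x \<in> B) \<and> (z \<noteq> w \<longrightarrow> (\<forall>\<^sub>F x in z. x \<notin> B))"
      if "ultrafilter z" for z
      using ultrafilter_separate[OF w(1) that] by (cases "z = w") (auto intro: exI[of _ UNIV])
    from *[OF U] *[OF V] obtain B1 B2 where
      "\<forall>\<^sub>F x in w. x \<in> B1" "U n \<noteq> w \<longrightarrow> (\<forall>\<^sub>F x in U n. x \<notin> B1)"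
      "\<forall>\<^sub>F x in w. x \<in> B2" "V n \<noteq> w \<longrightarrow> (\<forall>\<^sub>F x in V n. x \<notin> B2)" by metis
    then show ?thesis
      by (intro exI[of _ "B1 \<inter> B2"]) (auto simp: eventually_conj_iff elim: eventually_mono)
  qed
  then obtain B where Bw: "\<And>n. \<forall>\<^sub>F x in w. x \<in> B n"
    and BU: "\<And>n. U n \<noteq> w \<Longrightarrow> \<forall>\<^sub>F x in U n. x \<notin> B n"
    and BV: "\<And>n. V n \<noteq> w \<Longrightarrow> \<forall>\<^sub>F x in V n. x \<notin> B n" by metis
  \<comment> \<open>\<open>E n\<close> belongs to \<open>p\<close> because \<open>B n\<close>
    belongs to \<open>w\<close>, the common limit.\<close>
  define E where "E n = {m. (\<forall>\<^sub>F x in U m. x \<in> B n) \<and> (\<forall>\<^sub>F x in V m. x \<in> B n)}" for n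
  have "\<forall>\<^sub>F m in p. m \<in> E n" for n
    using Bw[of n] by (simp add: E_def eventually_conj_iff limU limV)
  from selective_diagonal[of p E, OF sel this] obtain A0 where A0: "\<forall>\<^sub>F x in p. x \<in> A0"
    and diag: "\<forall>n\<in>A0. \<forall>m\<in>A0. n < m \<longrightarrow> m \<in> E n"
    by blast
  define A where "A = {n \<in> A0. U n \<noteq> w \<and> V n \<noteq> w \<and> U n \<noteq> V n}"
  have A: "\<forall>\<^sub>F x in p. x \<in> A" using A0 nU nV ne by eventually_elim (auto simp: A_def)
  \<comment> \<open>For \<open>n < m\<close> in \<open>A\<close>, \<open>C m\<close> lies inside
    \<open>B n\<close> while \<open>C n\<close> avoids it. The diagonal property supplies the
    earlier \<open>B k\<close>.\<close>
  define C where "C n = {x. (\<forall>k\<in>A \<inter> {..<n}. x \<in> B k) \<and> x \<notin> B n}" for n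
  have C: "\<forall>\<^sub>F x in z. x \<in> C n" if "n \<in> A" "z = U n \<or> z = V n" for n z
  proof -
    have "\<forall>\<^sub>F x in z. \<forall>k\<in>A \<inter> {..<n}. x \<in> B k"
      using that diag by (intro eventually_ball_finite) (auto simp: A_def E_def)
    moreover have "\<forall>\<^sub>F x in z. x \<notin> B n" using that BU[of n] BV[of n] by (auto simp: A_def)
    ultimately show ?thesis by eventually_elim (auto simp: C_def)
  qed
  have disj: "n = m" if "n \<in> A" "m \<in> A" "x \<in> C n" "x \<in> C m" for n m x
    using that by (cases n m rule: linorder_cases) (auto simp: C_def)
  have "\<forall>n\<in>A. \<exists>D. (\<forall>\<^sub>F x in U n. x \<in> D) \<and> (\<forall>\<^sub>F x in V n. x \<notin> D)"
    using ultrafilter_separate[OF U V] by (auto simp: A_def)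
  then obtain D where D: "\<And>n. n \<in> A \<Longrightarrow> \<forall>\<^sub>F x in U n. x \<in> D n" "\<And>n. n \<in> A \<Longrightarrow> \<forall>\<^sub>F x in V n. x \<notin> D n"
    by metis
  \<comment> \<open>Inside \<open>C n\<close>, disjointness leaves only the piece \<open>D n\<close>
    of \<open>S\<close>, so \<open>S\<close> is in \<open>U n\<close> but not in
    \<open>V n\<close>.\<close>
  define S where "S = (\<Union>n\<in>A. C n \<inter> D n)"
  have "\<forall>\<^sub>F n in p. \<forall>\<^sub>F x in U n. x \<in> S"
    using A
  proof (rule eventually_mono)
    fix n assume n: "n \<in> A"
    show "\<forall>\<^sub>F x in U n. x \<in> S"
      using C[OF n disjI1[OF refl]] D(1)[OF n] by eventually_elim (use n in \<open>auto simp: S_def\<close>)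
  qed
  then have "\<forall>\<^sub>F n in p. \<forall>\<^sub>F x in V n. x \<in> S"
    by (simp only: limU limV)
  then have "\<forall>\<^sub>F n in p. False"
    using A
  proof eventually_elim
    case (elim n)
    have "\<forall>\<^sub>F x in V n. False"
      using elim(1) C[OF elim(2) disjI2[OF refl]] D(2)[OF elim(2)]
      by eventually_elim (use disj elim(2) in \<open>auto simp: S_def\<close>)
    then show ?case using V[of n] by (simp add: ultrafilter_def eventually_False)
  qed
  then show False using p by (simp add: ultrafilter_def eventually_False)
qed

section \<open>The class of iterated limits\<close>

text \<open>Replaces the transfinite hierarchy by an inductive set, so that later arguments can use
  structural induction.\<close>

lemma G_class_eq_G_closure:
  assumes "ultrafilter p"
  shows "G_class p = G_closure p"
proof
  show "G_class p \<subseteq> G_closure p"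
    unfolding G_class_def using G_level_subset_G_closure by fast
  show "G_closure p \<subseteq> G_class p"
    using assms G_closure_subset_G_class by (auto simp: ultrafilter_def)
qed

text \<open>Limits in the left summand pull out of the sum; once that summand is principal,
  translation commutes with limits on the right.\<close>

lemma G_closure_ultra_sum:
  assumes "u \<in> G_closure p" "v \<in> G_closure p"
  shows "ultra_sum u v \<in> G_closure p"
  using assms(1)
proof induction
  case (principal n)
  show ?case using assms(2)
  proof induction
    case (principal m)
    have "ultra_sum (principal {n}) (principal {m}) = principal {n + m}"
      by (simp add: filter_eq_iff eventually_ultra_sum eventually_principal)
    then show ?case by (simp add: G_closure.principal)
  next
    case (lim V)
    have "ultra_sum (principal {n}) (ultra_lim p V) = ultra_lim p (\<lambda>k. ultra_sum (principal {n}) (V k))"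
      by (simp add: filter_eq_iff ultra_sum_principal_left eventually_ultra_lim)
    then show ?case using lim.IH by (simp add: G_closure.lim)
  qed
next
  case (lim U)
  then show ?case by (simp add: ultra_sum_lim_left G_closure.lim)
qed

lemma G_closure_ultra_power:
  assumes "u \<in> G_closure p" "n \<ge> 1"
  shows "ultra_power u n \<in> G_closure p"
  using assms(2)
proof (induction n rule: dec_induct)
  case base
  then show ?case using assms(1) by (simp add: ultra_power_1[simplified])
next
  case (step n)
  then show ?case using assms(1) by (simp add: ultra_power_Suc G_closure_ultra_sum)
qed

text \<open>The equation \<open>ultra_sum e e = e\<close> does not pass to the components of
  \<open>e\<close>, so the left summand and the value are freed; the induction on \<open>c\<close>
  keeps \<open>s\<close> arbitrary.\<close>

lemma G_closure_ultra_sum_idempotent_neq: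
  assumes sel: "selective p" and e: "e \<in> G_closure p" "nonprincipal e" "ultra_sum e e = e"
    and "c \<in> G_closure p" "s \<in> G_closure p"
  shows "ultra_sum s e \<noteq> c"
proof -
  have p: "ultrafilter p" using sel by (simp add: selective_def)
  have pb: "p \<noteq> bot" using p by (simp add: ultrafilter_def)
  have uf: "ultrafilter u" if "u \<in> G_closure p" for u
    using G_class_ultrafilter[OF p] G_class_eq_G_closure[OF p] that by blast
  have nb: "u \<noteq> bot" if "u \<in> G_closure p" for u using uf[OF that] by (simp add: ultrafilter_def)
  show ?thesis
    using assms(5,6)
  proof (induction arbitrary: s)
    case (principal n)
    then show ?case
      using nonprincipal_ultra_sum[of s e] nb e by (auto simp: nonprincipal_def)
  next
    case (lim C)
    let ?c = "ultra_lim p C"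
    note IH_C = lim.IH and C = lim.hyps
    have c: "?c \<in> G_closure p" by (rule G_closure.lim) (rule lim.hyps)
    show ?case
    proof
      assume eq: "ultra_sum s e = ?c"
      have ncC: "\<not> (\<forall>\<^sub>F n in p. C n = ?c)"
      proof
        assume "\<forall>\<^sub>F n in p. C n = ?c"
        then obtain n where "C n = ?c" using eventually_happens' pb by blast
        then show False using lim.IH[of s n] lim.prems eq by simp
      qed
      \<comment> \<open>Stated for every \<open>t\<close>, since it is applied below to
        \<open>ultra_sum s e\<close> rather than to \<open>s\<close>.\<close>
      have pr: "\<exists>m. t = principal {m}" if "t \<in> G_closure p" "ultra_sum t e = ?c" for t
        using that
      proof induction
        case (lim T)
        have eqT: "ultra_lim p (\<lambda>n. ultra_sum (T n) e) = ?c"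
          using lim.prems by (simp add: ultra_sum_lim_left)
        have "\<forall>\<^sub>F n in p. ultra_sum (T n) e = ?c"
        proof (rule ccontr)
          assume nc: "\<not> ?thesis"
          have "\<forall>\<^sub>F n in p. ultra_sum (T n) e = C n"
            using selective_lim_unique[OF sel _ _ uf[OF c] eqT refl nc ncC]
              uf[OF G_closure_ultra_sum[OF lim.hyps e(1)]] uf[OF C] by blast
          then obtain n where "ultra_sum (T n) e = C n" using eventually_happens' pb by blast
          then show False using IH_C[OF lim.hyps] by blast
        qed
        then have ev: "\<forall>\<^sub>F n in p. ultra_sum (T n) e = ?c \<and> (\<exists>m. T n = principal {m})"
          by eventually_elim (use lim.IH in blast)
        then obtain k m where k: "ultra_sum (T k) e = ?c" "T k = principal {m}"
          using eventually_happens' pb by blast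
        \<comment> \<open>Almost all \<open>T n\<close> are principal and have the same sum with
          \<open>e\<close>, so cancellation makes them one and the same.\<close>
        have "\<forall>\<^sub>F n in p. T n = principal {m}"
          using ev by eventually_elim (use k ultra_sum_principal_cancel[OF uf[OF e(1)]] in metis)
        then show ?case using ultra_lim_eventually_const[OF pb] by blast
      qed blast
      \<comment> \<open>Idempotence makes \<open>ultra_sum s e\<close> another solution
        \<open>t\<close>, but a sum with nonprincipal right summand cannot be principal.\<close>
      have "ultra_sum (ultra_sum s e) e = ?c" using eq e(3) ultra_sum_assoc[of s e e] by simp
      then have "\<exists>m. ultra_sum s e = principal {m}"
        by (intro pr G_closure_ultra_sum lim.prems e(1))
      then show False
        using nonprincipal_ultra_sum[of s e] nb[OF lim.prems] nb[OF e(1)] e(2)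
        by (auto simp: nonprincipal_def)
    qed
  qed
qed

section \<open>Absence of idempotents and distinctness of powers\<close>

lemma G_closure_not_idempotent:
  assumes "selective p" "e \<in> G_closure p" "nonprincipal e"
  shows "ultra_sum e e \<noteq> e"
  using G_closure_ultra_sum_idempotent_neq[OF assms _ assms(2,2)] by blast

lemma G_closure_ultra_power_neq:
  assumes sel: "selective p" and u: "u \<in> G_closure p" "nonprincipal u" and n: "n \<ge> 1" "n < m"
  shows "ultra_power u n \<noteq> ultra_power u m"
proof
  assume "ultra_power u n = ultra_power u m"
  then obtain N where N: "N \<ge> 1" "ultra_sum (ultra_power u N) (ultra_power u N) = ultra_power u N"
    using ultra_power_idempotent[OF n] by blast
  have p: "ultrafilter p" using sel by (simp add: selective_def)
  have nb: "v \<noteq> bot" if "v \<in> G_closure p" for v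
    using G_class_ultrafilter[OF p] G_class_eq_G_closure[OF p] that by (auto simp: ultrafilter_def)
  have "nonprincipal (ultra_power u N)"
    using N(1)
  proof (induction N rule: dec_induct)
    case base
    then show ?case using u(2) by (simp add: ultra_power_1[simplified])
  next
    case (step k)
    then show ?case
      using nonprincipal_ultra_sum[OF nb[OF G_closure_ultra_power[OF u(1) step(1)]] nb[OF u(1)] u(2)]
      by (simp add: ultra_power_Suc)
  qed
  then show False
    using G_closure_not_idempotent[OF sel G_closure_ultra_power[OF u(1) N(1)]] N(2) by blast
qed

theorem theorem3p19:
  fixes p :: "nat filter"
  assumes "selective p"
  shows "(\<forall>u\<in>G_class p. nonprincipal u \<longrightarrow> generates_free_subsemigroup u)
       \<and> (\<forall>u\<in>G_class p. \<not> idempotent_ultrafilter u)"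
proof -
  have cl: "G_class p = G_closure p"
    using assms G_class_eq_G_closure by (simp add: selective_def)
  show ?thesis
    unfolding cl generates_free_subsemigroup_def idempotent_ultrafilter_def
    using G_closure_not_idempotent[OF assms] G_closure_ultra_power_neq[OF assms]
    by (metis linorder_neqE_nat)
qed

end
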